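(* For all $n\in\mathbb{Z}$ and all $\tau\in\mathbb{C}\setminus\mathbb{R}$, with $q=e^{2\pi i\tau}$, one has $$\sum_{k\in\mathbb{Z}}\varphi_{\overline{B}_n}(\tau+k)=2i\,(2\pi i)^{-n}\begin{cases}\delta_{-n}(q) & \text{if } |q|<1,\ \text{i.e. } \Im\tau>0,\\[2pt] (-1)^{n-1}\,\delta_{-n}(q^{-1}) & \text{if } |q|>1,\ \text{i.e. } \Im\tau<0.\end{cases}$$ (The classical Lipschitz summation formula corresponds to the cases $n\le -1$.)
   Context: Delta rational functions: for $n\in\mathbb{Z}$ and $|q|<1$, $\delta_n(q)=\sum_{k=1}^{\infty}k^nq^k$. Periodic Bernoulli functions and distributions: let $B_n(x)$ denote the $n$-th Bernoulli polynomial, $[x]$ the integer part of $x$, $\delta_{\mathbb{T}}(x)=\sum_{k\in\mathbb{Z}}e^{2\pi ikx}$ the 1-periodic delta distribution and $\delta_{\mathbb{T}}^{(k)}$ its $k$-th derivative. Set $$\widetilde{B}_n(x)=\begin{cases}-\dfrac{B_n(x-[x])}{n!} & n\ge1,\\ -1+\delta_{\mathbb{T}}(x) & n=0,\\ \delta_{\mathbb{T}}^{(-n)}(x) & n<0.\end{cases}$$ $\overline{B}_n$ denotes the restriction of $\widetilde{B}_n$ to $[0,1]$, regarded as a hyperfunction with support in $[0,1]$, where the periodic delta and its derivatives are counted once per period. That is, $\overline{B}_n$ is $-B_n(x)/n!$ on $[0,1]$ (zero outside) for $n\ge1$, $-\mathbf{1}_{[0,1]}+\delta$ for $n=0$, and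 $\delta^{(-n)}$ for $n<0$, where $\delta$ is the Dirac delta at $0$. $\varphi_{\overline{B}_n}$ is the holomorphic function on $\overline{\mathbb{C}}\setminus[0,1]$, vanishing at $\infty$, which represents $\overline{B}_n$: $$\varphi_{\overline{B}_n}(\tau)=\left\langle \overline{B}_n,\ \frac1\pi\,\frac{1}{x-\tau}\right\rangle_{[0,1]},$$ the pairing being in the variable $x$. Explicitly, it is $-\frac{1}{\pi\, n!}\int_0^1\frac{B_n(x)}{x-\tau}\,dx$ for $n\ge1$; $-\frac1\pi\int_0^1\frac{dx}{x-\tau}-\frac{1}{\pi\tau}$ for $n=0$; and $(-1)^{-n+1}\frac{(-n)!}{\pi\,\tau^{-n+1}}$ for $n<0$. *)

theory Defs
  imports "HOL-Complex_Analysis.Complex_Analysis"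
begin

definition delta_fun :: "int \<Rightarrow> complex \<Rightarrow> complex" where
  "delta_fun n q = (\<Sum>\<^sub>\<infinity>k\<in>{1::nat..}. of_nat k powi n * q ^ k)"

text \<open>Generating function: \<open>t exp (x t) / (exp t - 1) = (\<Sum>n. B\<^sub>n(x) t^n / n!)\<close>.\<close>

definition bernoulli_polynomial :: "nat \<Rightarrow> real \<Rightarrow> real" where
  "bernoulli_polynomial n x =
     fact n * fps_nth (fps_X * fps_exp x / (fps_exp 1 - 1)) n"

text \<open>
  A hyperfunction supported in \<open>[0,1]\<close> is an analytic functional: it is given by its pairing
  with functions holomorphic in a neighbourhood of \<open>[0,1]\<close>. Functions integrable on
  \<open>[0,1]\<close> act by integration, and the \<open>m\<close>-th derivative of the Dirac
  delta at \<open>0\<close> acts by \<open>f \<mapsto> (-1)^m f\<^sup>(\<^sup>m\<^sup>)(0)\<close>.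
\<close>

definition dirac_deriv :: "nat \<Rightarrow> (complex \<Rightarrow> complex) \<Rightarrow> complex" where
  "dirac_deriv m f = (-1) ^ m * (deriv ^^ m) f 0"

definition function_functional :: "(real \<Rightarrow> real) \<Rightarrow> (complex \<Rightarrow> complex) \<Rightarrow> complex" where
  "function_functional g f = integral {0..1} (\<lambda>x. complex_of_real (g x) * f (of_real x))"

text \<open>
  The integer-periodic delta contributes a single delta, at \<open>0\<close>, although both endpoints
  of \<open>[0,1]\<close> are integers.
\<close>

definition Bbar :: "int \<Rightarrow> (complex \<Rightarrow> complex) \<Rightarrow> complex" where
  "Bbar n f =
     (if n \<ge> 1 then
        function_functional (\<lambda>x. - bernoulli_polynomial (nat n) x / fact (nat n)) f
      else if n = 0 then function_functional (\<lambda>x. - 1) f + dirac_deriv 0 f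
      else dirac_deriv (nat (- n)) f)"

text \<open>Only meaningful for \<open>\<tau>\<close> outside \<open>[0,1]\<close>.\<close>

definition phi_Bbar :: "int \<Rightarrow> complex \<Rightarrow> complex" where
  "phi_Bbar n \<tau> = Bbar n (\<lambda>x. 1 / of_real pi * (1 / (x - \<tau>)))"

end

theory Submission imports Defs begin

text \<open>
  Put \<open>\<epsilon> = 1\<close> if \<open>Im \<tau> > 0\<close> and \<open>\<epsilon> = - 1\<close> if \<open>Im \<tau> < 0\<close>, let
  \<open>c = 2 \<pi> \<i> \<epsilon>\<close> and \<open>p = exp (c \<tau>)\<close>. Then \<open>p\<close> is whichever of \<open>q\<close>, \<open>1 / q\<close>
  lies inside the unit disc, and both cases of the formula say that the sum over \<open>k\<close> is
  \<open>(c / \<pi>) c^(-n) \<delta>\<^sub>-\<^sub>n(p)\<close> (\<open>phi_Bbar_has_sum\<close>).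

  For \<open>n = - m < 0\<close> this is the classical Lipschitz formula
  \<open>\<Sum>k. (\<tau> + k)^(-m-1) = ((- c)^(m+1) / m!) \<delta>\<^sub>m(p)\<close> (\<open>Lipschitz_summation\<close>). It comes from
  the logarithmic derivative of Euler's reflection formula for \<open>\<Gamma>\<close>, namely
  \<open>\<psi>(1 - z) - \<psi>(z) = \<pi> cot (\<pi> z)\<close>: the cotangent is a constant plus a multiple of
  \<open>\<delta>\<^sub>0(p)\<close>, differentiating \<open>m\<close> times turns \<open>\<delta>\<^sub>0\<close> into \<open>\<delta>\<^sub>m\<close>, and the left-hand side
  becomes a two-sided sum by the series of the polygamma functions.

  For \<open>n \<ge> 0\<close> let \<open>G(x) = (B\<^sub>n\<^sub>+\<^sub>1(1) - B\<^sub>n\<^sub>+\<^sub>1(x)) / (n+1)!\<close>, a primitive of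
  \<open>- B\<^sub>n / n!\<close>. Integration by parts gives
  \<open>\<phi>\<^sub>n(s) = (1 / \<pi>) \<integral>\<^sub>0\<^sup>1 G(x) / (x - s)^2 dx\<close> (\<open>phi_Bbar_nonneg\<close>). The only boundary
  term is \<open>G(0) / s\<close>. Since \<open>G(0)\<close> is \<open>1\<close> for \<open>n = 0\<close> and \<open>0\<close> otherwise, it is cancelled
  by the delta at the origin, which is present precisely when \<open>n = 0\<close>. In this form the sum over
  \<open>s = \<tau> + k\<close> converges uniformly in \<open>x\<close>, so that it may be carried out under the integral
  with the Lipschitz formula for \<open>m = 1\<close>. Expanding \<open>\<delta>\<^sub>1(exp (c (\<tau> - x)))\<close> in powers of
  \<open>p\<close> leaves the Fourier coefficients \<open>\<integral>\<^sub>0\<^sup>1 G(x) exp (- c j x) dx = (c j)^(-n-1)\<close>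
  (\<open>bernoulli_primitive_fourier\<close>), and \<open>j \<cdot> j^(-n-1) = j^(-n)\<close> reassembles \<open>\<delta>\<^sub>-\<^sub>n(p)\<close>.
\<close>

section \<open>Delta rational functions as power series\<close>

lemma summable_powi_times_power:
  fixes z :: complex
  assumes "norm z < 1"
  shows "summable (\<lambda>k. of_nat k powi n * z ^ k)"
proof -
  have pow: "summable (\<lambda>k. of_nat k ^ m * z ^ k)" if "norm z < 1" for m :: nat and z :: complex
    using that
  proof (induction m arbitrary: z)
    case 0
    then show ?case by (simp add: summable_geometric)
  next
    case (Suc m)
    \<comment> \<open>Apply \<open>z d/dz\<close>: a power series may be differentiated termwise inside its disc.\<close>
    have "summable (\<lambda>k. diffs (\<lambda>k. of_nat k ^ m :: complex) k * z ^ k)"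
      by (rule termdiff_converges[of z 1]) (use Suc in auto)
    then have "summable (\<lambda>k. diffs (\<lambda>k. of_nat k ^ m :: complex) k * z ^ k * z)"
      by (rule summable_mult2)
    then have "summable (\<lambda>k. of_nat (Suc k) ^ Suc m * z ^ Suc k)"
      by (simp add: diffs_def mult_ac)
    then show ?case by (subst (asm) summable_Suc_iff)
  qed
  show ?thesis
  proof (rule summable_comparison_test')
    show "summable (\<lambda>k. real k ^ nat \<bar>n\<bar> * norm z ^ k)"
    proof -
      have "summable (\<lambda>k. complex_of_real (real k ^ nat \<bar>n\<bar> * norm z ^ k))"
        using pow[of "of_real (norm z)" "nat \<bar>n\<bar>"] assms by simp
      then show ?thesis unfolding summable_of_real_iff .
    qed
    show "norm (of_nat k powi n * z ^ k) \<le> real k ^ nat \<bar>n\<bar> * norm z ^ k" if "k \<ge> 1" for k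
    proof -
      have "real k powi n \<le> real k powi \<bar>n\<bar>" using that by (intro power_int_increasing) auto
      then have "real k powi n \<le> real k ^ nat \<bar>n\<bar>" by (simp add: power_int_def)
      then show ?thesis
        by (simp add: norm_mult norm_power norm_power_int mult_right_mono)
    qed
  qed
qed

lemma delta_fun_has_sum:
  assumes "norm q < 1"
  shows "((\<lambda>k. of_nat k powi n * q ^ k) has_sum delta_fun n q) {1::nat..}"
    and "(\<lambda>k. norm (of_nat k powi n * q ^ k)) summable_on {1::nat..}"
proof -
  have "summable (\<lambda>k. norm (of_nat k powi n * q ^ k))"
  proof -
    have "summable (\<lambda>k. complex_of_real (real k powi n * norm q ^ k))"
      using summable_powi_times_power[of "of_real (norm q)" n] assms by simp
    then have "summable (\<lambda>k. real k powi n * norm q ^ k)"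
      unfolding summable_of_real_iff .
    then show ?thesis by (simp add: norm_mult norm_power norm_power_int)
  qed
  then show *: "(\<lambda>k. norm (of_nat k powi n * q ^ k)) summable_on {1::nat..}"
    by (intro summable_on_subset_banach[OF norm_summable_imp_summable_on]) auto
  show "((\<lambda>k. of_nat k powi n * q ^ k) has_sum delta_fun n q) {1::nat..}"
    unfolding delta_fun_def using abs_summable_summable[OF *] by (rule has_sum_infsum)
qed

lemma delta_fun_sums:
  assumes "norm q < 1"
  shows "(\<lambda>k. of_nat (Suc k) powi n * q ^ Suc k) sums delta_fun n q"
proof -
  have "bij_betw Suc UNIV {1..}"
    by (rule bij_betwI[of _ _ _ "\<lambda>k. k - 1"]) auto
  from has_sum_reindex_bij_betw[OF this, of "\<lambda>k. of_nat k powi n * q ^ k"] delta_fun_has_sum(1)[OF assms, of n]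
  have "((\<lambda>k. of_nat (Suc k) powi n * q ^ Suc k) has_sum delta_fun n q) UNIV"
    by blast
  then show ?thesis by (rule has_sum_imp_sums)
qed

text \<open>
  Equivalently \<open>q \<delta>\<^sub>n'(q) = \<delta>\<^sub>n\<^sub>+\<^sub>1(q)\<close>: the Euler operator multiplies the coefficient of
  \<open>q^k\<close> by \<open>k\<close>.
\<close>

lemma delta_fun_has_field_derivative:
  assumes "norm q < 1" "q \<noteq> 0"
  shows "(delta_fun n has_field_derivative delta_fun (n + 1) q / q) (at q)"
proof -
  define c where "c = (\<lambda>k. if k = 0 then 0 else (of_nat k :: complex) powi n)"
  have c_sums: "(\<lambda>k. c k * z ^ k) sums delta_fun n z" if "norm z < 1" for z
    using sums_Suc[of "\<lambda>k. c k * z ^ k", of "delta_fun n z"] delta_fun_sums[OF that, of n]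
    by (simp add: c_def del: of_nat_Suc power_Suc)
  have "diffs c k = of_nat (Suc k) powi (n + 1)" for k
    unfolding diffs_def c_def by (simp add: power_int_add_1' del: of_nat_Suc)
  moreover have "(\<lambda>k. of_nat (Suc k) powi (n + 1) * q ^ k) sums (delta_fun (n + 1) q / q)"
    using sums_divide[OF delta_fun_sums[OF assms(1), of "n + 1"], of q] assms(2)
    by (simp del: of_nat_Suc)
  ultimately have "(\<Sum>k. diffs c k * q ^ k) = delta_fun (n + 1) q / q"
    by (simp add: sums_iff)
  with termdiffs_strong'[of 1 c q] c_sums assms
  have "((\<lambda>z. \<Sum>k. c k * z ^ k) has_field_derivative delta_fun (n + 1) q / q) (at q)"
    by (simp add: sums_iff)
  then show ?thesis
    by (rule has_field_derivative_transform_within_open[where S = "ball 0 1"])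
       (use assms c_sums in \<open>auto simp: sums_iff\<close>)
qed

section \<open>Reflection formula for the polygamma functions\<close>

text \<open>
  The product \<open>\<Gamma>(w) \<Gamma>(1 - w) sin (\<pi> w)\<close> is constant, so its derivative vanishes; dividing that
  derivative by \<open>\<Gamma>(z) \<Gamma>(1 - z)\<close> gives the claim.
\<close>

lemma Digamma_reflection:
  fixes z :: complex
  assumes "z \<notin> \<int>"
  shows "Digamma (1 - z) - Digamma z = of_real pi * cot (of_real pi * z)"
proof -
  have nonpos: "w \<notin> \<int>\<^sub>\<le>\<^sub>0" "1 - w \<notin> \<int>\<^sub>\<le>\<^sub>0" if "w \<notin> \<int>" for w :: complex
    using that nonpos_Ints_subset_Ints Ints_diff[of 1 "1 - w"] by auto
  have sin0: "sin (of_real pi * w) \<noteq> 0" if "w \<notin> \<int>" for w :: complex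
    using that by (auto simp: sin_eq_0)
  let ?f = "\<lambda>w::complex. Gamma w * Gamma (1 - w) * sin (of_real pi * w)"
  let ?G = "Gamma z * Gamma (1 - z)"
  have "(?f has_field_derivative ?G * ((Digamma z - Digamma (1 - z)) * sin (of_real pi * z)
           + of_real pi * cos (of_real pi * z))) (at z)"
    using nonpos[OF assms]
    by (auto intro!: derivative_eq_intros simp: algebra_simps)
  moreover have "(?f has_field_derivative 0) (at z)"
  proof (rule has_field_derivative_transform_within_open)
    show "((\<lambda>_. of_real pi) has_field_derivative 0) (at z)" by simp
    show "open (- \<int> :: complex set)" by (simp add: open_Compl)
    show "of_real pi = ?f w" if "w \<in> - \<int>" for w
      using that sin0[of w] by (simp add: Gamma_reflection_complex)
  qed (use assms in auto)
  ultimately have "?G * ((Digamma z - Digamma (1 - z)) * sin (of_real pi * z)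
           + of_real pi * cos (of_real pi * z)) = 0"
    by (rule DERIV_unique)
  moreover have "?G \<noteq> 0" using nonpos[OF assms] by (simp add: Gamma_eq_zero_iff)
  ultimately have "(Digamma z - Digamma (1 - z)) * sin (of_real pi * z)
      + of_real pi * cos (of_real pi * z) = 0"
    by (metis mult_eq_0_iff)
  then show ?thesis using sin0[OF assms] by (simp add: cot_def field_simps)
qed

section \<open>Sums over the integers\<close>

lemma has_sum_int_split:
  fixes f :: "int \<Rightarrow> 'a :: {topological_comm_monoid_add,t2_space}"
  assumes "((\<lambda>n. f (int n)) has_sum a) UNIV" "((\<lambda>n. f (- 1 - int n)) has_sum b) UNIV"
  shows "(f has_sum (a + b)) UNIV"
proof -
  have "(f has_sum a) (range int)"
    using assms(1) by (subst has_sum_reindex) (auto simp: o_def)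
  moreover have "(f has_sum b) (range (\<lambda>n. - 1 - int n))"
    using assms(2) by (subst has_sum_reindex) (auto simp: o_def inj_on_def)
  ultimately have "(f has_sum (a + b)) (range int \<union> range (\<lambda>n. - 1 - int n))"
    by (rule has_sum_Un_disjoint) auto
  also have "range int \<union> range (\<lambda>n. - 1 - int n) = UNIV"
  proof -
    have "k \<in> range int \<union> range (\<lambda>n. - 1 - int n)" for k
      by (cases "k \<ge> 0") (auto simp: image_iff intro: exI[of _ "nat k"] exI[of _ "nat (- 1 - k)"])
    then show ?thesis by blast
  qed
  finally show ?thesis .
qed

lemma summable_on_inverse_square_int:
  "(\<lambda>k::int. 1 / (1 + \<bar>real_of_int k\<bar>) ^ 2) summable_on UNIV"
proof -
  have sums: "(\<lambda>n. 1 / (1 + real n)^2) sums (pi^2/6)"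
    using inverse_squares_sums by (simp add: add_ac)
  then have "((\<lambda>n. 1 / (1 + real n)^2) has_sum (pi^2/6)) UNIV"
    by (intro norm_summable_imp_has_sum) (auto simp: sums_iff)
  moreover have "summable (\<lambda>n. 1 / (1 + real (Suc n))^2)"
    using sums_summable[OF sums] by (subst summable_Suc_iff)
  then have "((\<lambda>n. 1 / (1 + real (Suc n))^2) has_sum (\<Sum>n. 1 / (1 + real (Suc n))^2)) UNIV"
    by (intro norm_summable_imp_has_sum summable_sums) auto
  ultimately have "((\<lambda>k. 1 / (1 + \<bar>real_of_int k\<bar>) ^ 2) has_sum
      (pi^2/6 + (\<Sum>n. 1 / (1 + real (Suc n))^2))) UNIV"
    by (intro has_sum_int_split) (simp_all add: abs_if)
  then show ?thesis by (rule has_sum_imp_summable)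
qed

text \<open>
  The triangle inequality bounds \<open>\<bar>k\<bar>\<close> by \<open>norm (z + k) + R\<close>, and \<open>norm (z + k) \<ge> \<bar>Im z\<bar>\<close>
  absorbs the remaining constant \<open>1 + R\<close> into a multiple of \<open>norm (z + k)\<close>. A bound depending on
  \<open>z\<close> only through \<open>R\<close> and \<open>Im z\<close> is what makes the later estimates uniform on a horizontal
  segment.
\<close>

lemma norm_shift_ge:
  fixes z :: complex
  assumes "Im z \<noteq> 0" "norm z \<le> R"
  shows "1 + \<bar>real_of_int k\<bar> \<le> (1 + (1 + R) / \<bar>Im z\<bar>) * norm (z + of_int k)"
proof -
  have "\<bar>Im z\<bar> \<le> norm (z + of_int k)"
    using abs_Im_le_cmod[of "z + of_int k"] by simp
  then have "1 + R \<le> (1 + R) / \<bar>Im z\<bar> * norm (z + of_int k)"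
    using mult_left_mono[of "\<bar>Im z\<bar>" "norm (z + of_int k)" "(1 + R) / \<bar>Im z\<bar>"]
      assms order_trans[OF norm_ge_zero assms(2)] by simp
  moreover have "\<bar>real_of_int k\<bar> \<le> norm (z + of_int k) + R"
    using norm_triangle_ineq4[of "z + of_int k" z] assms(2) by (simp add: add_ac)
  ultimately show ?thesis by (simp add: algebra_simps)
qed

lemma norm_inverse_power_shift_le:
  fixes z :: complex
  assumes "Im z \<noteq> 0" "norm z \<le> R"
  shows "norm (1 / (z + of_int k) ^ m) \<le> (1 + (1 + R) / \<bar>Im z\<bar>) ^ m / (1 + \<bar>real_of_int k\<bar>) ^ m"
proof -
  have "z + of_int k \<noteq> 0" using assms by (auto simp: complex_eq_iff)
  moreover have "(1 + \<bar>real_of_int k\<bar>) ^ m \<le> ((1 + (1 + R) / \<bar>Im z\<bar>) * norm (z + of_int k)) ^ m"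
    by (intro power_mono norm_shift_ge assms) auto
  ultimately show ?thesis
    unfolding power_mult_distrib by (simp add: norm_divide norm_power divide_simps mult_ac)
qed

lemma abs_summable_inverse_power_int:
  fixes z :: complex
  assumes "Im z \<noteq> 0" "m \<ge> 2"
  shows "(\<lambda>k::int. norm (1 / (z + of_int k) ^ m)) summable_on UNIV"
proof (rule Infinite_Sum.abs_summable_on_comparison_test')
  define C where "C = (1 + (1 + norm z) / \<bar>Im z\<bar>) ^ m"
  have "C \<ge> 0" by (simp add: C_def)
  show "(\<lambda>k. C * (1 / (1 + \<bar>real_of_int k\<bar>) ^ 2)) summable_on UNIV"
    by (intro summable_on_cmult_right summable_on_inverse_square_int)
  show "norm (1 / (z + of_int k) ^ m) \<le> C * (1 / (1 + \<bar>real_of_int k\<bar>) ^ 2)" for k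
  proof -
    have "(1 + \<bar>real_of_int k\<bar>) ^ 2 \<le> (1 + \<bar>real_of_int k\<bar>) ^ m"
      using assms(2) by (intro power_increasing) auto
    then have "C / (1 + \<bar>real_of_int k\<bar>) ^ m \<le> C / (1 + \<bar>real_of_int k\<bar>) ^ 2"
      using \<open>C \<ge> 0\<close> by (intro divide_left_mono mult_pos_pos) (auto simp: add_pos_nonneg)
    then show ?thesis
      using norm_inverse_power_shift_le[OF assms(1) order.refl, of k m] by (simp add: C_def)
  qed
qed

section \<open>Lipschitz summation formula\<close>

text \<open>
  With \<open>w = exp (\<i> \<pi> z)\<close> the cotangent is \<open>\<i> (w\<^sup>2 + 1) / (w\<^sup>2 - 1)\<close>, where \<open>w\<^sup>2\<close> is \<open>p\<close> or
  \<open>1 / p\<close> according to the sign \<open>e\<close>; the geometric series sums \<open>\<delta>\<^sub>0(p)\<close> to \<open>p / (1 - p)\<close>.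
\<close>

lemma cot_eq_delta_fun:
  assumes "e = 1 \<or> e = -1" "e * Im z > 0"
  defines "p \<equiv> exp (2 * of_real pi * \<i> * of_real e * z)"
  shows "cot (of_real pi * z) = - \<i> * of_real e * (1 + 2 * delta_fun 0 p)"
proof -
  define w where "w = exp (\<i> * (of_real pi * z))"
  have w: "w \<noteq> 0" by (simp add: w_def)
  have winv: "exp (- (\<i> * (of_real pi * z))) = inverse w" by (simp add: w_def exp_minus)
  have "norm p < 1" using assms(1,2) by (auto simp: p_def mult_pos_neg)
  then have "(\<lambda>k. p ^ k * p) sums (1 / (1 - p) * p)"
    by (intro sums_mult2 geometric_sums)
  then have d: "delta_fun 0 p = p / (1 - p)"
    using sums_unique2 delta_fun_sums[OF \<open>norm p < 1\<close>, of 0] by (force simp: mult_ac)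
  have "p \<noteq> 1" using \<open>norm p < 1\<close> by auto
  have w2: "exp (2 * of_real pi * \<i> * z) = w ^ 2"
    by (simp add: w_def power2_eq_square mult_exp_exp algebra_simps)
  have "p = w ^ 2 \<and> e = 1 \<or> p = inverse w ^ 2 \<and> e = -1"
    using assms(1) w2 by (auto simp: p_def exp_minus power_inverse)
  moreover have "cot (of_real pi * z) = \<i> * ((w ^ 2 + 1) / (w ^ 2 - 1))"
  proof -
    have "a / 2 / (b / (2 * \<i>)) = \<i> * (a / b)" for a b :: complex
      by (simp add: divide_simps) (simp add: algebra_simps)?
    moreover have "(w + inverse w) / (w - inverse w) = (w ^ 2 + 1) / (w ^ 2 - 1)"
      using w mult_divide_mult_cancel_left[OF w, of "w + inverse w" "w - inverse w"]
      by (simp add: algebra_simps power2_eq_square)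
    ultimately show ?thesis
      unfolding cot_def sin_exp_eq cos_exp_eq winv w_def[symmetric] by (simp only:)
  qed
  moreover have "1 + 2 * delta_fun 0 p = (1 + p) / (1 - p)"
    using \<open>p \<noteq> 1\<close> by (simp add: d field_simps)
  moreover have "(p + 1) / (p - 1) = - ((1 + p) / (1 - p))"
    using minus_divide_right[of "1 + p" "1 - p"] by (simp add: add_ac)
  moreover have "(w ^ 2 + 1) / (w ^ 2 - 1) = (1 + p) / (1 - p)" if "p = inverse w ^ 2"
    using w mult_divide_mult_cancel_left[of "w ^ 2" "1 + p" "1 - p"]
    by (simp add: that algebra_simps power_inverse)
  ultimately show ?thesis
    by (auto simp del: times_divide_eq_right times_divide_eq_left)
qed

text \<open>
  The case \<open>m = 0\<close> is the reflection formula for the digamma function. Each further case is the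
  derivative of the preceding one, and the first differentiation removes the constant
  \<open>\<i> \<pi> e\<close>.
\<close>

lemma Polygamma_reflection_delta_fun:
  assumes "e = 1 \<or> e = -1" "e * Im z > 0"
  shows "Polygamma m z - (-1) ^ m * Polygamma m (1 - z) =
    (if m = 0 then \<i> * of_real (e * pi) else 0) +
    (2 * of_real pi * \<i> * of_real e) ^ Suc m *
      delta_fun (int m) (exp (2 * of_real pi * \<i> * of_real e * z))"
  using assms(2)
proof (induction m arbitrary: z)
  case 0
  then have "z \<notin> \<int>" by (auto elim: Ints_cases)
  then have "Digamma z - Digamma (1 - z) = - (of_real pi * cot (of_real pi * z))"
    using Digamma_reflection[of z] by (simp add: algebra_simps)
  then show ?case
    unfolding cot_eq_delta_fun[OF assms(1) 0] by (simp add: algebra_simps)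
next
  case (Suc m)
  define c where "c = 2 * of_real pi * \<i> * of_real e"
  let ?q = "exp (c * z)"
  have nonpos: "z \<notin> \<int>\<^sub>\<le>\<^sub>0" "1 - z \<notin> \<int>\<^sub>\<le>\<^sub>0"
    using Suc.prems nonpos_Ints_subset_Ints by (auto elim!: Ints_cases simp: complex_eq_iff)
  have q: "norm ?q < 1"
    using assms(1) Suc.prems by (auto simp: c_def mult_pos_neg)
  let ?L = "\<lambda>z. Polygamma m z - (-1) ^ m * Polygamma m (1 - z)"
  let ?R = "\<lambda>z. (if m = 0 then \<i> * of_real (e * pi) else 0) + c ^ Suc m * delta_fun (int m) (exp (c * z))"
  have "(?L has_field_derivative Polygamma (Suc m) z - (-1) ^ Suc m * Polygamma (Suc m) (1 - z)) (at z)"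
    using nonpos by (auto intro!: derivative_eq_intros)
  moreover have "(?L has_field_derivative c ^ Suc (Suc m) * delta_fun (int (Suc m)) ?q) (at z)"
  proof (rule has_field_derivative_transform_within_open)
    have "((\<lambda>z. exp (c * z)) has_field_derivative c * ?q) (at z)"
      by (auto intro!: derivative_eq_intros)
    from DERIV_chain2[of "delta_fun (int m)" _ "\<lambda>z. exp (c * z)", OF
        delta_fun_has_field_derivative[OF q exp_not_eq_zero] this]
    have "((\<lambda>z. delta_fun (int m) (exp (c * z))) has_field_derivative
        c * delta_fun (int (Suc m)) ?q) (at z)"
      by (simp add: add_ac mult_ac)
    then show "(?R has_field_derivative c ^ Suc (Suc m) * delta_fun (int (Suc m)) ?q) (at z)"
      by (intro DERIV_cong[OF DERIV_add[OF DERIV_const DERIV_cmult]]) (auto simp: mult_ac)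
    have "{w. e * Im w > 0} = (if e = 1 then {w. Im w > 0} else {w. Im w < 0})"
      using assms(1) by auto
    then show "open {w. e * Im w > 0}"
      by (simp add: open_halfspace_Im_gt open_halfspace_Im_lt)
    show "?R w = ?L w" if "w \<in> {w. e * Im w > 0}" for w
      using Suc.IH[of w] that by (simp add: c_def)
  qed (use Suc.prems in auto)
  ultimately show ?case
    using DERIV_unique by (fastforce simp: c_def)
qed

text \<open>
  The terms with \<open>k \<ge> 0\<close> are the series of the polygamma function at \<open>z\<close>, and those with
  \<open>k < 0\<close> the series at \<open>1 - z\<close> up to the sign \<open>(-1)^(m+1)\<close>.
\<close>

lemma Lipschitz_summation:
  assumes "e = 1 \<or> e = -1" "e * Im z > 0" "m \<ge> 1"
  shows "((\<lambda>k::int. 1 / (z + of_int k) ^ Suc m) has_sum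
    ((- 2 * of_real pi * \<i> * of_real e) ^ Suc m / fact m *
      delta_fun (int m) (exp (2 * of_real pi * \<i> * of_real e * z)))) UNIV"
proof -
  let ?f = "\<lambda>k::int. 1 / (z + of_int k) ^ Suc m"
  have "Im z \<noteq> 0" using assms by auto
  then have *: "?f summable_on UNIV"
    using assms(3) by (intro abs_summable_summable[OF abs_summable_inverse_power_int]) auto
  define S where "S = (\<lambda>z::complex. \<Sum>k. inverse ((z + of_nat k) ^ Suc m))"
  have P: "Polygamma m w = (-1) ^ Suc m * fact m * S w" for w :: complex
    using assms(3) by (simp add: Polygamma_def S_def)
  have nat: "((\<lambda>n. ?f (h n)) has_sum (\<Sum>n. ?f (h n))) UNIV" if "inj h" for h :: "nat \<Rightarrow> int"
  proof -
    have "?f summable_on range h" by (rule summable_on_subset_banach[OF *]) auto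
    then have "(\<lambda>n. ?f (h n)) summable_on UNIV" using that by (simp add: summable_on_reindex o_def)
    then have "((\<lambda>n. ?f (h n)) has_sum (\<Sum>\<^sub>\<infinity>n. ?f (h n))) UNIV" by (rule has_sum_infsum)
    with sums_unique[OF has_sum_imp_sums[OF this]] show ?thesis by (simp only:)
  qed
  have 1: "((\<lambda>n. ?f (int n)) has_sum S z) UNIV"
    using nat[of int] by (simp add: S_def inverse_eq_divide del: power_Suc)
  have "1 / (z + of_int (- 1 - int n)) ^ Suc m = (-1) ^ Suc m * inverse ((1 - z + of_nat n) ^ Suc m)" for n
  proof -
    have "z + of_int (- 1 - int n) = - (1 - z + of_nat n)" by simp
    then have "(z + of_int (- 1 - int n)) ^ Suc m = (-1) ^ Suc m * (1 - z + of_nat n) ^ Suc m"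
      using power_minus[of "1 - z + of_nat n" "Suc m"] by (simp only:)
    moreover have "1 / ((-1) ^ N * w) = (-1) ^ N * inverse w" for N and w :: complex
      by (cases "even N") (simp_all add: inverse_eq_divide)
    ultimately show ?thesis by (simp only:)
  qed
  moreover have "summable (\<lambda>n. inverse ((1 - z + of_nat n) ^ Suc m))"
    using \<open>Im z \<noteq> 0\<close> assms(3) by (intro Polygamma_converges') (auto simp: complex_eq_iff)
  ultimately have 2: "((\<lambda>n. ?f (- 1 - int n)) has_sum ((-1) ^ Suc m * S (1 - z))) UNIV"
    using nat[of "\<lambda>n. - 1 - int n"] unfolding S_def
    by (simp add: inj_def suminf_mult del: power_Suc)
  have "(?f has_sum (S z + (-1) ^ Suc m * S (1 - z))) UNIV"
    by (rule has_sum_int_split[OF 1 2])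
  also have "S z + (-1) ^ Suc m * S (1 - z) =
    (-1) ^ Suc m * (Polygamma m z - (-1) ^ m * Polygamma m (1 - z)) / fact m"
    unfolding P by (simp add: field_simps flip: power_add)
  also have "\<dots> = (- 2 * of_real pi * \<i> * of_real e) ^ Suc m / fact m *
      delta_fun (int m) (exp (2 * of_real pi * \<i> * of_real e * z))"
  proof -
    have "(- 2 * of_real pi * \<i> * of_real e) ^ Suc m
        = (-1) ^ Suc m * (2 * of_real pi * \<i> * of_real e) ^ Suc m"
      unfolding power_mult_distrib[symmetric] by simp
    then show ?thesis
      unfolding Polygamma_reflection_delta_fun[OF assms(1,2)]
      using assms(3) by (simp del: power_Suc)
  qed
  finally show ?thesis .
qed

section \<open>Interchange of summation and integration\<close>

text \<open>
  The bound \<open>M\<close> makes the finite partial sums converge uniformly on the interval, by the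
  Weierstrass test along the filter of finite subsets.
\<close>

lemma has_sum_integral:
  fixes f :: "'i \<Rightarrow> real \<Rightarrow> complex"
  assumes cont: "\<And>k. continuous_on {a..b} (f k)"
    and bound: "\<And>k x. k \<in> K \<Longrightarrow> x \<in> {a..b} \<Longrightarrow> norm (f k x) \<le> M k"
    and M: "M summable_on K"
    and S: "\<And>x. x \<in> {a..b} \<Longrightarrow> ((\<lambda>k. f k x) has_sum S x) K"
  shows "((\<lambda>k. integral {a..b} (f k)) has_sum integral {a..b} S) K"
proof -
  let ?F = "finite_subsets_at_top K"
  have "uniform_limit {a..b} (\<lambda>X x. \<Sum>k\<in>X. f k x) S ?F"
    by (rule Weierstrass_m_test_general'[OF bound S M])
  moreover have "continuous_on {a..b} (\<lambda>x. \<Sum>k\<in>X. f k x)" for X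
    by (intro continuous_on_sum cont)
  ultimately obtain I J where
    I: "\<And>X. ((\<lambda>x. \<Sum>k\<in>X. f k x) has_integral I X) {a..b}" and J: "(S has_integral J) {a..b}"
    and lim: "(I \<longlongrightarrow> J) ?F"
    by (rule uniform_limit_integral[OF _ _ finite_subsets_at_top_neq_bot]) blast
  have "I X = (\<Sum>k\<in>X. integral {a..b} (f k))" if "finite X" for X
    using integral_unique[OF I[of X]] integral_sum[OF that, of f "{a..b}"] integrable_continuous_interval[OF cont]
    by simp
  then have "\<forall>\<^sub>F X in ?F. I X = (\<Sum>k\<in>X. integral {a..b} (f k))"
    by (intro eventually_finite_subsets_at_top_weakI)
  with lim show ?thesis
    unfolding has_sum_def integral_unique[OF J] by (simp add: tendsto_cong)
qed

section \<open>Bernoulli polynomials and their Fourier coefficients\<close>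

definition normalized_bernoulli :: "nat \<Rightarrow> real \<Rightarrow> real" where
  "normalized_bernoulli n x = bernoulli_polynomial n x / fact n"

text \<open>
  The quotient \<open>X exp (x X) / (exp X - 1)\<close> is formed as a whole in the definition of the
  polynomials. Because \<open>exp X - 1\<close> divides \<open>X\<close> as a power series, the factor \<open>exp (x X)\<close>
  can be pulled out, which isolates the dependence on \<open>x\<close>.
\<close>

lemma normalized_bernoulli_eq_fps_nth:
  defines "H \<equiv> fps_X / (fps_exp 1 - 1 :: real fps)"
  shows "normalized_bernoulli n x = fps_nth (H * fps_exp x) n"
    and "H * (fps_exp 1 - 1) = fps_X"
proof -
  let ?E = "fps_exp 1 - 1 :: real fps"
  have "fps_nth ?E 1 = 1" by simp
  then have "?E \<noteq> 0" "subdegree ?E \<le> 1"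
    by (force, intro subdegree_leI) auto
  then have "?E dvd fps_X" by (simp add: fps_dvd_iff)
  then show "H * ?E = fps_X" by (simp add: H_def)
  show "normalized_bernoulli n x = fps_nth (H * fps_exp x) n"
    using \<open>?E dvd fps_X\<close>
    by (simp add: normalized_bernoulli_def bernoulli_polynomial_def H_def div_mult_swap mult.commute)
qed

lemma normalized_bernoulli_0 [simp]: "normalized_bernoulli 0 x = 1"
proof -
  define H where "H = fps_X / (fps_exp 1 - 1 :: real fps)"
  have "fps_nth (H * (fps_exp 1 - 1)) 1 = 1"
    unfolding H_def normalized_bernoulli_eq_fps_nth(2) by simp
  then show ?thesis
    unfolding normalized_bernoulli_eq_fps_nth(1) H_def[symmetric]
    by (simp add: fps_mult_nth)
qed

lemma normalized_bernoulli_1_minus_0: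
  "normalized_bernoulli (Suc n) 1 - normalized_bernoulli (Suc n) 0 = (if n = 0 then 1 else 0)"
proof -
  define H where "H = fps_X / (fps_exp 1 - 1 :: real fps)"
  have "normalized_bernoulli (Suc n) 1 - normalized_bernoulli (Suc n) 0
      = fps_nth (H * (fps_exp 1 - 1)) (Suc n)"
    unfolding normalized_bernoulli_eq_fps_nth(1) H_def[symmetric] by (simp add: algebra_simps)
  then show ?thesis
    unfolding H_def normalized_bernoulli_eq_fps_nth(2) by simp
qed

lemma normalized_bernoulli_has_real_derivative:
  "(normalized_bernoulli (Suc n) has_real_derivative normalized_bernoulli n x) (at x within A)"
proof -
  define H where "H = fps_X / (fps_exp 1 - 1 :: real fps)"
  have eq: "normalized_bernoulli n = (\<lambda>x. \<Sum>i\<le>n. fps_nth H i * (x ^ (n - i) / fact (n - i)))" for n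
    unfolding normalized_bernoulli_eq_fps_nth(1) H_def[symmetric]
    by (simp add: fps_mult_nth fun_eq_iff atLeast0AtMost)
  have "((\<lambda>x. fps_nth H i * (x ^ (Suc n - i) / fact (Suc n - i))) has_real_derivative
      fps_nth H i * (x ^ (n - i) / fact (n - i))) (at x within A)" if "i \<le> n" for i
  proof -
    have "((\<lambda>x. h * (x ^ Suc k / fact (Suc k))) has_real_derivative h * (x ^ k / fact k)) (at x within A)"
      for k and h :: real
    proof -
      have "real (Suc k) * x ^ k / fact (Suc k) = x ^ k / fact k"
        by (simp add: fact_Suc del: of_nat_Suc)
      then show ?thesis
        using DERIV_cmult[OF DERIV_cdivide[OF DERIV_pow[of "Suc k" x A], of "fact (Suc k)"], of h]
        by simp
    qed
    then show ?thesis using that by (simp add: Suc_diff_le del: power_Suc fact_Suc)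
  qed
  then have "((\<lambda>x. \<Sum>i\<le>n. fps_nth H i * (x ^ (Suc n - i) / fact (Suc n - i))) has_real_derivative
      (\<Sum>i\<le>n. fps_nth H i * (x ^ (n - i) / fact (n - i)))) (at x within A)"
    by (intro DERIV_sum) auto
  then have "((\<lambda>x. (\<Sum>i\<le>n. fps_nth H i * (x ^ (Suc n - i) / fact (Suc n - i))) + fps_nth H (Suc n)) has_real_derivative
      (\<Sum>i\<le>n. fps_nth H i * (x ^ (n - i) / fact (n - i)))) (at x within A)"
    using DERIV_add[OF _ DERIV_const] by fastforce
  then show ?thesis unfolding eq by simp
qed

lemma continuous_on_normalized_bernoulli [continuous_intros]:
  "continuous_on A (normalized_bernoulli n)"
proof (cases n)
  case 0
  then have "normalized_bernoulli n = (\<lambda>_. 1)" by auto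
  then show ?thesis by simp
next
  case (Suc m)
  then show ?thesis
    using DERIV_continuous_on normalized_bernoulli_has_real_derivative by blast
qed

text \<open>
  The constant of integration is chosen to make this primitive of \<open>- B\<^sub>n / n!\<close> vanish at
  \<open>1\<close>. Its value at \<open>0\<close> is then the mass at the origin of the distribution attached to
  \<open>n\<close>.
\<close>

definition bernoulli_primitive :: "nat \<Rightarrow> real \<Rightarrow> real" where
  "bernoulli_primitive n x = normalized_bernoulli (Suc n) 1 - normalized_bernoulli (Suc n) x"

lemma bernoulli_primitive_0: "bernoulli_primitive n 0 = (if n = 0 then 1 else 0)"
  by (simp add: bernoulli_primitive_def normalized_bernoulli_1_minus_0)

lemma bernoulli_primitive_1 [simp]: "bernoulli_primitive n 1 = 0"
  by (simp add: bernoulli_primitive_def)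

lemma continuous_on_bernoulli_primitive [continuous_intros]:
  "continuous_on A (bernoulli_primitive n)"
  unfolding bernoulli_primitive_def by (intro continuous_intros)

lemma bernoulli_primitive_bounded:
  obtains B where "\<And>x. x \<in> {0..1} \<Longrightarrow> \<bar>bernoulli_primitive n x\<bar> \<le> B"
proof -
  have "compact (bernoulli_primitive n ` {0..1})"
    by (intro compact_continuous_image continuous_intros) auto
  then obtain B where "\<forall>y \<in> bernoulli_primitive n ` {0..1}. norm y \<le> B"
    using compact_imp_bounded bounded_iff by blast
  then show thesis using that[of B] by auto
qed

text \<open>
  As the primitive vanishes at \<open>1\<close>, only the endpoint \<open>0\<close> contributes, and only for \<open>n = 0\<close>:
  the term \<open>- v 0\<close> then offsets the pairing of \<open>v\<close> with the delta at the origin.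
\<close>

lemma integral_bernoulli_by_parts:
  fixes v v' :: "complex \<Rightarrow> complex"
  assumes v: "\<And>x. x \<in> {0..1} \<Longrightarrow> (v has_field_derivative v' (of_real x)) (at (of_real x))"
    and v': "continuous_on {0..1} (\<lambda>x. v' (of_real x))"
  shows "integral {0..1} (\<lambda>x. - of_real (normalized_bernoulli n x) * v (of_real x)) =
    - (if n = 0 then v 0 else 0) - integral {0..1} (\<lambda>x. of_real (bernoulli_primitive n x) * v' (of_real x))"
proof -
  let ?b = "\<lambda>x. - complex_of_real (normalized_bernoulli n x)"
  let ?G = "\<lambda>x. complex_of_real (bernoulli_primitive n x)"
  have v_vec: "((\<lambda>x. v (of_real x)) has_vector_derivative v' (of_real x)) (at x within {0..1})"
    if "x \<in> {0..1}" for x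
    using has_vector_derivative_real_field[OF v[OF that]] .
  have "(bernoulli_primitive n has_real_derivative - normalized_bernoulli n x) (at x within {0..1})" for x
    unfolding bernoulli_primitive_def
    by (auto intro!: derivative_eq_intros normalized_bernoulli_has_real_derivative)
  then have G_vec: "(?G has_vector_derivative ?b x) (at x within {0..1})" for x
    using has_vector_derivative_of_real has_real_derivative_iff_has_vector_derivative by fastforce
  have "((\<lambda>x. ?G x * v' (of_real x) + ?b x * v (of_real x)) has_integral
      ?G 1 * v (of_real 1) - ?G 0 * v (of_real 0)) {0..1}"
    by (intro fundamental_theorem_of_calculus has_vector_derivative_mult v_vec G_vec) auto
  moreover have "continuous_on {0..1} (\<lambda>x. v (of_real x))"
    using v_vec by (intro continuous_on_vector_derivative)
  then have int_b: "(\<lambda>x. ?b x * v (of_real x)) integrable_on {0..1}"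
    by (intro integrable_continuous_interval continuous_intros)
  moreover have "(\<lambda>x. ?G x * v' (of_real x)) integrable_on {0..1}"
    by (intro integrable_continuous_interval continuous_intros v')
  ultimately show ?thesis
    using Henstock_Kurzweil_Integration.integral_add[of "\<lambda>x. ?G x * v' (of_real x)" "{0..1}" "\<lambda>x. ?b x * v (of_real x)"]
    by (simp add: bernoulli_primitive_0 has_integral_iff split: if_splits)
qed

text \<open>
  Integration by parts against \<open>exp (- c x)\<close> lowers \<open>n\<close> by one at the price of a factor
  \<open>1 / c\<close>: up to a constant, which is orthogonal to the exponential, \<open>- B\<^sub>n\<^sub>+\<^sub>1 / (n+1)!\<close> is
  the primitive of index \<open>n\<close>. For \<open>n = 0\<close> only the boundary term at \<open>0\<close> survives.
\<close>

lemma bernoulli_primitive_fourier: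
  fixes c :: complex
  assumes "c \<noteq> 0" "exp c = 1"
  shows "integral {0..1} (\<lambda>x. of_real (bernoulli_primitive n x) * exp (- c * of_real x)) = 1 / c ^ Suc n"
proof -
  let ?v = "\<lambda>x. exp (- c * x)"
  let ?I = "\<lambda>n. integral {0..1} (\<lambda>x. of_real (bernoulli_primitive n x) * ?v (of_real x))"
  let ?b = "\<lambda>n. integral {0..1} (\<lambda>x. - of_real (normalized_bernoulli n x) * ?v (of_real x))"
  have I_b: "c * ?I n = ?b n + (if n = 0 then 1 else 0)" for n
  proof -
    have "?b n = - (if n = 0 then ?v 0 else 0)
        - integral {0..1} (\<lambda>x. of_real (bernoulli_primitive n x) * (- c * ?v (of_real x)))"
      by (rule integral_bernoulli_by_parts) (auto intro!: derivative_eq_intros continuous_intros)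
    also have "integral {0..1} (\<lambda>x. of_real (bernoulli_primitive n x) * (- c * ?v (of_real x))) = - c * ?I n"
      by (subst integral_mult_right[symmetric]) (simp add: mult_ac)
    finally show ?thesis by (simp split: if_splits)
  qed
  have exp0: "((\<lambda>x. ?v (of_real x)) has_integral 0) {0..1}"
  proof -
    have "((\<lambda>x. ?v (of_real x)) has_integral ?v (of_real 1) / (- c) - ?v (of_real 0) / (- c)) {0..1}"
      using assms(1)
      by (intro fundamental_theorem_of_calculus has_vector_derivative_real_field)
         (auto intro!: derivative_eq_intros)
    then show ?thesis using assms(2) by (simp add: exp_minus)
  qed
  show ?thesis
  proof (induction n)
    case 0
    have "?b 0 = 0" using integral_unique[OF exp0] by simp
    then show ?case using I_b[of 0] assms(1) by (simp add: field_simps)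
  next
    case (Suc n)
    let ?d = "complex_of_real (normalized_bernoulli (Suc n) 1)"
    have "?b (Suc n) = integral {0..1} (\<lambda>x. of_real (bernoulli_primitive n x) * ?v (of_real x) - ?d * ?v (of_real x))"
      by (simp add: bernoulli_primitive_def algebra_simps)
    also have "\<dots> = ?I n - integral {0..1} (\<lambda>x. ?d * ?v (of_real x))"
      by (intro Henstock_Kurzweil_Integration.integral_diff integrable_continuous_interval continuous_intros)
    also have "integral {0..1} (\<lambda>x. ?d * ?v (of_real x)) = 0"
      using integral_unique[OF exp0] by simp
    finally have "c * ?I (Suc n) = 1 / c ^ Suc n"
      using I_b[of "Suc n"] Suc.IH by simp
    then show ?case using assms(1) by (simp add: field_simps)
  qed
qed

section \<open>The functions representing the restricted distributions\<close>

lemma higher_deriv_simple_pole: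
  fixes s :: complex
  assumes "w \<noteq> s"
  shows "(deriv ^^ m) (\<lambda>x. a * (1 / (x - s))) w = (-1) ^ m * fact m * a / (w - s) ^ Suc m"
  using assms
proof (induction m arbitrary: w)
  case (Suc m)
  have "((deriv ^^ m) (\<lambda>x. a * (1 / (x - s))) has_field_derivative
      (-1) ^ Suc m * fact (Suc m) * a / (w - s) ^ Suc (Suc m)) (at w)"
  proof (rule has_field_derivative_transform_within_open)
    have "((\<lambda>x. (-1) ^ m * fact m * a * inverse ((x - s) ^ Suc m)) has_field_derivative
       (-1) ^ m * fact m * a * - (inverse ((w - s) ^ Suc m) * (of_nat (Suc m) * (w - s) ^ m) * inverse ((w - s) ^ Suc m))) (at w)"
      using Suc.prems
      by (auto intro!: derivative_eq_intros simp del: power_Suc)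
    also have "(-1) ^ m * fact m * a * - (inverse ((w - s) ^ Suc m) * (of_nat (Suc m) * (w - s) ^ m) * inverse ((w - s) ^ Suc m))
       = (-1) ^ Suc m * fact (Suc m) * a / (w - s) ^ Suc (Suc m)"
    proof -
      have "(-1) ^ m * fact m * a * - (inverse (d ^ Suc m) * (of_nat (Suc m) * d ^ m) * inverse (d ^ Suc m))
          = (-1) ^ Suc m * fact (Suc m) * a / d ^ Suc (Suc m)" if "d \<noteq> 0" for d :: complex
        using that by (simp add: field_simps)
      then show ?thesis using Suc.prems by simp
    qed
    finally show "((\<lambda>x. (-1) ^ m * fact m * a / (x - s) ^ Suc m) has_field_derivative
      (-1) ^ Suc m * fact (Suc m) * a / (w - s) ^ Suc (Suc m)) (at w)"
      by (simp add: divide_inverse)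
    show "open (- {s})" by (simp add: open_Compl)
    show "(-1) ^ m * fact m * a / (x - s) ^ Suc m = (deriv ^^ m) (\<lambda>x. a * (1 / (x - s))) x" if "x \<in> - {s}" for x
      using Suc.IH[of x] that by simp
  qed (use Suc.prems in auto)
  then show ?case by (simp add: DERIV_imp_deriv)
qed auto

lemma phi_Bbar_neg:
  assumes "m \<ge> 1" "s \<noteq> 0"
  shows "phi_Bbar (- int m) s = (-1) ^ Suc m * fact m / (of_real pi * s ^ Suc m)"
proof -
  have "(deriv ^^ m) (\<lambda>x. 1 / of_real pi * (1 / (x - s))) 0 = (-1) ^ m * fact m * (1 / of_real pi) / (0 - s) ^ Suc m"
    using assms by (intro higher_deriv_simple_pole) auto
  moreover have "(0 - s) ^ Suc m = (-1) ^ Suc m * s ^ Suc m"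
    using power_minus[of s "Suc m"] by simp
  ultimately show ?thesis
    using assms(1) unfolding phi_Bbar_def Bbar_def dirac_deriv_def
    by (cases "even m") (simp_all add: mult_ac)
qed

text \<open>
  A single formula for \<open>n = 0\<close> and \<open>n \<ge> 1\<close>: for \<open>n = 0\<close> the contribution \<open>1 / (0 - s)\<close> of the
  delta cancels the boundary term. The double pole also improves the decay in \<open>s\<close> to
  second order, so that the sum over integer translates converges absolutely.
\<close>

lemma phi_Bbar_nonneg:
  assumes "Im s \<noteq> 0"
  shows "phi_Bbar (int n) s =
    1 / of_real pi * integral {0..1} (\<lambda>x. of_real (bernoulli_primitive n x) / (of_real x - s) ^ 2)"
proof -
  have ne: "of_real x \<noteq> s" for x using assms by auto
  have *: "integral {0..1} (\<lambda>x. - of_real (normalized_bernoulli n x) * (1 / (of_real x - s))) =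
    - (if n = 0 then 1 / (0 - s) else 0)
    - integral {0..1} (\<lambda>x. of_real (bernoulli_primitive n x) * (- 1 / (of_real x - s) ^ 2))"
    using ne by (intro integral_bernoulli_by_parts)
      (auto intro!: derivative_eq_intros continuous_intros simp: power2_eq_square)
  have "integral {0..1} (\<lambda>x. - of_real (normalized_bernoulli n x) * (1 / of_real pi * (1 / (of_real x - s)))) =
    1 / of_real pi * integral {0..1} (\<lambda>x. - of_real (normalized_bernoulli n x) * (1 / (of_real x - s)))"
    by (subst integral_mult_right[symmetric]) (simp add: mult_ac)
  moreover have "bernoulli_polynomial 0 x = 1" for x
    using normalized_bernoulli_0[of x] by (simp add: normalized_bernoulli_def)
  ultimately have "phi_Bbar (int n) s = 1 / of_real pi * (integral {0..1} (\<lambda>x. - of_real (normalized_bernoulli n x) * (1 / (of_real x - s)))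
     + (if n = 0 then 1 / (0 - s) else 0))"
    by (cases "n = 0") (simp_all add: phi_Bbar_def Bbar_def function_functional_def dirac_deriv_def normalized_bernoulli_def algebra_simps)
  then show ?thesis unfolding * by simp
qed

section \<open>Summation over integer translates\<close>

text \<open>
  Expanding \<open>\<delta>\<^sub>1\<close> termwise produces \<open>j q^j\<close> times the Fourier coefficient
  \<open>(c j)^(-n-1)\<close>.
\<close>

lemma integral_bernoulli_primitive_delta_fun:
  assumes "e = 1 \<or> e = -1" "norm q < 1"
  defines "c \<equiv> 2 * of_real pi * \<i> * of_real e"
  shows "integral {0..1} (\<lambda>x. of_real (bernoulli_primitive n x) * delta_fun 1 (q * exp (- c * of_real x)))
    = delta_fun (- int n) q / c ^ Suc n"
proof -
  let ?G = "\<lambda>x. complex_of_real (bernoulli_primitive n x)"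
  let ?K = "{1::nat..}"
  define f where "f = (\<lambda>(j::nat) x. ?G x * (of_nat j * (q * exp (- c * of_real x)) ^ j))"
  have c0: "c \<noteq> 0" using assms(1) by (auto simp: c_def)
  have norm_exp: "norm (exp (- c * of_real x)) = 1" for x by (simp add: c_def)
  obtain B where B: "\<And>x. x \<in> {0..1} \<Longrightarrow> norm (?G x) \<le> B"
    using bernoulli_primitive_bounded[of n] by (metis norm_of_real)
  have "((\<lambda>j. integral {0..1} (f j)) has_sum
      integral {0..1} (\<lambda>x. ?G x * delta_fun 1 (q * exp (- c * of_real x)))) ?K"
  proof (rule has_sum_integral)
    show "continuous_on {0..1} (f j)" for j
      unfolding f_def by (intro continuous_intros)
    show "norm (f j x) \<le> B * norm (of_nat j powi 1 * q ^ j)" if "x \<in> {0..1}" for j x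
      using mult_right_mono[OF B[OF that], of "real j * norm q ^ j"] norm_exp[of x]
      unfolding f_def norm_mult norm_power norm_exp by simp
    show "(\<lambda>j. B * norm (of_nat j powi 1 * q ^ j)) summable_on ?K"
      by (intro summable_on_cmult_right delta_fun_has_sum assms)
    show "((\<lambda>j. f j x) has_sum ?G x * delta_fun 1 (q * exp (- c * of_real x))) ?K" for x
    proof -
      have "norm (q * exp (- c * of_real x)) < 1"
        using assms(2) by (simp only: norm_mult norm_exp mult_1_right)
      from has_sum_cmult_right[OF delta_fun_has_sum(1)[OF this, of 1], of "?G x"]
      show ?thesis by (simp add: f_def)
    qed
  qed
  moreover have "integral {0..1} (f j) = 1 / c ^ Suc n * (of_nat j powi (- int n) * q ^ j)"
    if "j \<in> ?K" for j
  proof -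
    have j: "of_nat j \<noteq> (0 :: complex)" using that by auto
    have "exp (of_nat j * c) = exp c ^ j" by (rule exp_of_nat_mult)
    also have "exp c = 1" using assms(1) by (auto simp: c_def exp_minus)
    finally have "exp (of_nat j * c) = 1" by simp
    from bernoulli_primitive_fourier[OF _ this, of n] c0 j
    have four: "integral {0..1} (\<lambda>x. ?G x * exp (- (of_nat j * c) * of_real x)) = 1 / (of_nat j * c) ^ Suc n"
      by simp
    have "f j = (\<lambda>x. (of_nat j * q ^ j) * (?G x * exp (- (of_nat j * c) * of_real x)))"
      by (simp add: f_def power_mult_distrib fun_eq_iff mult_ac flip: exp_of_nat_mult)
    then have "integral {0..1} (f j) = (of_nat j * q ^ j) * (1 / (of_nat j * c) ^ Suc n)"
      using four by simp
    also have "\<dots> = 1 / c ^ Suc n * (of_nat j powi (- int n) * q ^ j)"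
      using j c0 by (simp add: power_mult_distrib power_int_minus divide_simps)
    finally show ?thesis .
  qed
  ultimately have "((\<lambda>j. 1 / c ^ Suc n * (of_nat j powi (- int n) * q ^ j)) has_sum
      integral {0..1} (\<lambda>x. ?G x * delta_fun 1 (q * exp (- c * of_real x)))) ?K"
    by (rule has_sum_cong[THEN iffD1, rotated])
  then show ?thesis
    using has_sum_unique has_sum_cmult_right[OF delta_fun_has_sum(1)[OF assms(2), of "- int n"], of "1 / c ^ Suc n"]
    by fastforce
qed

lemma phi_Bbar_nonneg_has_sum:
  assumes "e = 1 \<or> e = -1" "e * Im \<tau> > 0"
  defines "c \<equiv> 2 * of_real pi * \<i> * of_real e"
  shows "((\<lambda>k::int. phi_Bbar (int n) (\<tau> + of_int k)) has_sum
    (c / of_real pi * (c powi (- int n) * delta_fun (- int n) (exp (c * \<tau>))))) UNIV"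
proof -
  let ?G = "\<lambda>x. complex_of_real (bernoulli_primitive n x)"
  define q where "q = exp (c * \<tau>)"
  have q: "norm q < 1" using assms(1,2) by (auto simp: q_def c_def mult_pos_neg)
  have c0: "c \<noteq> 0" using assms(1) by (auto simp: c_def)
  have Im0: "Im \<tau> \<noteq> 0" using assms(2) by auto
  define f where "f = (\<lambda>(k::int) x. ?G x / (of_real x - (\<tau> + of_int k)) ^ 2)"
  have f_eq: "f k x = ?G x * (1 / ((\<tau> - of_real x) + of_int k) ^ 2)" for k x
    unfolding f_def by (simp add: power2_eq_square algebra_simps)
  obtain B where B: "\<And>x. x \<in> {0..1} \<Longrightarrow> norm (?G x) \<le> B"
    using bernoulli_primitive_bounded[of n] by (metis norm_of_real)
  \<comment> \<open>The bound of \<open>norm_shift_ge\<close> with \<open>R = norm \<tau> + 1\<close>, valid for all \<open>\<tau> - x\<close> with \<open>0 \<le> x \<le> 1\<close>.\<close>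
  define C where "C = (1 + (2 + norm \<tau>) / \<bar>Im \<tau>\<bar>) ^ 2"
  have "((\<lambda>k. integral {0..1} (f k)) has_sum
     integral {0..1} (\<lambda>x. c ^ 2 * (?G x * delta_fun 1 (q * exp (- c * of_real x))))) UNIV"
  proof (rule has_sum_integral)
    show "continuous_on {0..1} (f k)" for k
    proof -
      have "of_real x - (\<tau> + of_int k) \<noteq> 0" for x using Im0 by (auto simp: complex_eq_iff)
      then show ?thesis unfolding f_def by (intro continuous_intros) auto
    qed
    show "norm (f k x) \<le> B * C * (1 / (1 + \<bar>real_of_int k\<bar>) ^ 2)" if "x \<in> {0..1}" for k x
    proof -
      have "norm (\<tau> - of_real x) \<le> norm \<tau> + 1"
        using norm_triangle_ineq4[of \<tau> "of_real x"] that by simp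
      then have "norm (1 / ((\<tau> - of_real x) + of_int k) ^ 2) \<le> C / (1 + \<bar>real_of_int k\<bar>) ^ 2"
        using norm_inverse_power_shift_le[of "\<tau> - of_real x" "norm \<tau> + 1" k 2] Im0
        by (simp add: C_def add_ac)
      then have "norm (?G x) * norm (1 / ((\<tau> - of_real x) + of_int k) ^ 2) \<le> B * (C / (1 + \<bar>real_of_int k\<bar>) ^ 2)"
        using B[OF that] order_trans[OF norm_ge_zero B[OF that]] by (intro mult_mono) auto
      then show ?thesis unfolding f_eq norm_mult by simp
    qed
    show "(\<lambda>k::int. B * C * (1 / (1 + \<bar>real_of_int k\<bar>) ^ 2)) summable_on UNIV"
      by (intro summable_on_cmult_right summable_on_inverse_square_int)
    show "((\<lambda>k. f k x) has_sum c ^ 2 * (?G x * delta_fun 1 (q * exp (- c * of_real x)))) UNIV" for x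
    proof -
      have "((\<lambda>k. ?G x * (1 / ((\<tau> - of_real x) + of_int k) ^ 2)) has_sum
         ?G x * (c ^ 2 * delta_fun 1 (exp (c * (\<tau> - of_real x))))) UNIV"
        using has_sum_cmult_right[OF Lipschitz_summation[OF assms(1), of "\<tau> - of_real x" 1], of "?G x"] assms(2)
        by (simp add: c_def power2_eq_square)
      then show ?thesis
        unfolding f_eq q_def by (simp add: mult_ac exp_diff exp_minus divide_inverse right_diff_distrib)
    qed
  qed
  also have "integral {0..1} (\<lambda>x. c ^ 2 * (?G x * delta_fun 1 (q * exp (- c * of_real x))))
     = c ^ 2 * (delta_fun (- int n) q / c ^ Suc n)"
    using integral_bernoulli_primitive_delta_fun[OF assms(1) q, of n] by (simp add: c_def)
  finally have "((\<lambda>k. 1 / of_real pi * integral {0..1} (f k)) has_sum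
     1 / of_real pi * (c ^ 2 * (delta_fun (- int n) q / c ^ Suc n))) UNIV"
    by (rule has_sum_cmult_right)
  also have "1 / of_real pi * (c ^ 2 * (delta_fun (- int n) q / c ^ Suc n)) =
    c / of_real pi * (c powi (- int n) * delta_fun (- int n) q)"
    using c0 by (simp add: power_int_minus power2_eq_square divide_simps)
  also have "(\<lambda>k. 1 / of_real pi * integral {0..1} (f k)) = (\<lambda>k::int. phi_Bbar (int n) (\<tau> + of_int k))"
    unfolding f_def using Im0 by (subst phi_Bbar_nonneg) auto
  finally show ?thesis unfolding q_def .
qed

lemma phi_Bbar_neg_has_sum:
  assumes "e = 1 \<or> e = -1" "e * Im \<tau> > 0" "m \<ge> 1"
  defines "c \<equiv> 2 * of_real pi * \<i> * of_real e"
  shows "((\<lambda>k::int. phi_Bbar (- int m) (\<tau> + of_int k)) has_sum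
    (c / of_real pi * (c powi int m * delta_fun (int m) (exp (c * \<tau>))))) UNIV"
proof -
  let ?a = "(-1) ^ Suc m * fact m / of_real pi :: complex"
  have "((\<lambda>k::int. ?a * (1 / (\<tau> + of_int k) ^ Suc m)) has_sum
      ?a * ((- c) ^ Suc m / fact m * delta_fun (int m) (exp (c * \<tau>)))) UNIV"
    using has_sum_cmult_right[OF Lipschitz_summation[OF assms(1-3)], of ?a] by (simp add: c_def del: power_Suc)
  also have "?a * ((- c) ^ Suc m / fact m * delta_fun (int m) (exp (c * \<tau>))) =
     c / of_real pi * (c powi int m * delta_fun (int m) (exp (c * \<tau>)))"
    unfolding power_minus[of c] by simp
  also have "(\<lambda>k::int. ?a * (1 / (\<tau> + of_int k) ^ Suc m)) = (\<lambda>k. phi_Bbar (- int m) (\<tau> + of_int k))"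
  proof
    fix k :: int
    have "\<tau> + of_int k \<noteq> 0" using assms(2) by (auto simp: complex_eq_iff)
    then show "?a * (1 / (\<tau> + of_int k) ^ Suc m) = phi_Bbar (- int m) (\<tau> + of_int k)"
      using phi_Bbar_neg[OF assms(3)] by simp
  qed
  finally show ?thesis .
qed

text \<open>
  The sign \<open>e\<close> of \<open>Im \<tau>\<close> enters only through \<open>c\<close>, so that the two half-planes are treated at
  once.
\<close>

lemma phi_Bbar_has_sum:
  assumes "e = 1 \<or> e = -1" "e * Im \<tau> > 0"
  defines "c \<equiv> 2 * of_real pi * \<i> * of_real e"
  shows "((\<lambda>k::int. phi_Bbar n (\<tau> + of_int k)) has_sum
    (c / of_real pi * (c powi (- n) * delta_fun (- n) (exp (c * \<tau>))))) UNIV"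
proof (cases "n \<ge> 0")
  case True
  then show ?thesis
    using phi_Bbar_nonneg_has_sum[OF assms(1,2), of "nat n"] by (simp add: c_def)
next
  case False
  then show ?thesis
    using phi_Bbar_neg_has_sum[OF assms(1,2), of "nat (- n)"] by (simp add: c_def)
qed

theorem theorem9:
  fixes n :: int and \<tau> q :: complex
  assumes "\<tau> \<notin> \<real>"
    and "q = exp (2 * of_real pi * \<i> * \<tau>)"
  shows "(cmod q < 1 \<longleftrightarrow> Im \<tau> > 0) \<and> (cmod q > 1 \<longleftrightarrow> Im \<tau> < 0) \<and>
    ((\<lambda>k::int. phi_Bbar n (\<tau> + of_int k)) has_sum
       (2 * \<i> * (2 * of_real pi * \<i>) powi (- n) *
          (if cmod q < 1 then delta_fun (- n) q
           else (-1) powi (n - 1) * delta_fun (- n) (inverse q)))) UNIV"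
proof -
  have norm_q: "cmod q = exp (- 2 * pi * Im \<tau>)" by (simp add: assms(2))
  have lt: "cmod q < 1 \<longleftrightarrow> Im \<tau> > 0" and gt: "cmod q > 1 \<longleftrightarrow> Im \<tau> < 0"
    by (simp_all add: norm_q zero_less_mult_iff mult_less_0_iff)
  let ?c = "2 * of_real pi * \<i>"
  have "Im \<tau> \<noteq> 0" using assms(1) by (simp add: complex_is_Real_iff)
  then consider "Im \<tau> > 0" | "Im \<tau> < 0" by linarith
  then have "((\<lambda>k::int. phi_Bbar n (\<tau> + of_int k)) has_sum
       (2 * \<i> * ?c powi (- n) *
          (if cmod q < 1 then delta_fun (- n) q
           else (-1) powi (n - 1) * delta_fun (- n) (inverse q)))) UNIV"
  proof cases
    case 1
    then show ?thesis
      using phi_Bbar_has_sum[of 1 \<tau> n] lt by (simp add: assms(2) mult_ac)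
  next
    case 2
    \<comment> \<open>Here \<open>c = - 2 \<pi> \<i>\<close>; the powers of \<open>- 1\<close> in \<open>c c^(-n)\<close> combine to \<open>(- 1)^(n - 1)\<close>.\<close>
    have "(- 1 :: complex) powi (n - 1) = - ((- 1) powi (- n))"
      by (simp add: power_int_diff power_int_minus flip: power_int_inverse)
    moreover have "(- ?c) powi (- n) = (- 1) powi (- n) * ?c powi (- n)"
      using power_int_mult_distrib[of "- 1" ?c "- n"] by simp
    moreover have "exp (- ?c * \<tau>) = inverse q" by (simp add: assms(2) exp_minus)
    ultimately show ?thesis
      using phi_Bbar_has_sum[of "- 1" \<tau> n] 2 lt by (simp add: mult_ac)
  qed
  with lt gt show ?thesis by blast
qed

end
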